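(* Let $k\ge 2$ be an integer and let $G$ be a graph of order $n$ with $\Psi(G)\ge k$. Then $mc_k(G)\ge e(G)-k(n-2)$.
   Context: All graphs are finite, simple and undirected; $e(G)$ denotes the number of edges of $G$ and the order is the number of vertices. For a partition $\mathcal{P}=\{V_1,\dots,V_s\}$ of $V(G)$ into nonempty disjoint sets, $G/\mathcal{P}$ is the (multi)graph obtained from $G$ by deleting, for each $i$, all edges with both ends in $V_i$ and then merging the vertices of $V_i$ into a single vertex (parallel edges are kept); $|G/\mathcal{P}|=|\mathcal{P}|=s$ is its number of vertices and $e(G/\mathcal{P})$ is its number of edges, i.e. the number of edges of $G$ joining different parts. Define $\psi(G)=\min_{|\mathcal{P}|\ge 2}\frac{e(G/\mathcal{P})}{|G/\mathcal{P}|-1}$, the minimum over all partitions $\mathcal{P}$ of $V(G)$ with at least two parts, and $\Psi(G)=\lfloor\psi(G)\rfloor$. (If $\Psi(G)\ge k$ then $G$ is $k$-edge-connected.) An edge-coloring assigns to each edge a color, where adjacent edges may receive the same color. A path is monochromatic if all its edges have the same color. For a $k$-edge-connected graph $G$, an $MC_k$-coloring of $G$ is an edge-coloring such that every two distinct vertices of $G$ are connected by at least $k$ pairwise edge-disjoint monochromatic paths (different paths may have different colors). The number $mc_k(G)$ is the maximum number of colors actually used by an $MC_k$-coloring of $G$. *)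

theory Defs
  imports Complex_Main "HOL-Library.Disjoint_Sets"
begin

definition simple_graph :: "'a set \<Rightarrow> 'a set set \<Rightarrow> bool" where
  "simple_graph V E \<longleftrightarrow> finite V \<and> (\<forall>e\<in>E. e \<subseteq> V \<and> card e = 2)"

(* The edges of the multigraph G/P. Representing each of them by the edge of G it comes from
   keeps parallel edges distinct. *)
definition quotient_edges :: "'a set set \<Rightarrow> 'a set set \<Rightarrow> 'a set set" where
  "quotient_edges E P = {e \<in> E. \<not> (\<exists>X\<in>P. e \<subseteq> X)}"

(* For finite V the minimum is over a finite set, which is nonempty iff V has at least two
   elements; otherwise the value is unspecified. *)
definition psi :: "'a set \<Rightarrow> 'a set set \<Rightarrow> real" where
  "psi V E = Min {real (card (quotient_edges E P)) / (real (card P) - 1) | P.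
     partition_on V P \<and> card P \<ge> 2}"

definition Psi :: "'a set \<Rightarrow> 'a set set \<Rightarrow> int" where
  "Psi V E = \<lfloor>psi V E\<rfloor>"

definition path_edges :: "'a list \<Rightarrow> 'a set set" where
  "path_edges p = {{p ! i, p ! Suc i} | i. Suc i < length p}"

definition path_between :: "'a set \<Rightarrow> 'a set set \<Rightarrow> 'a \<Rightarrow> 'a \<Rightarrow> 'a list \<Rightarrow> bool" where
  "path_between V E u v p \<longleftrightarrow>
     p \<noteq> [] \<and> hd p = u \<and> last p = v \<and> distinct p \<and> set p \<subseteq> V \<and> path_edges p \<subseteq> E"

(* Colors are natural numbers, which is no restriction for finitely many edges.
   Only the values of c on E matter. *)
definition monochromatic :: "('a set \<Rightarrow> nat) \<Rightarrow> 'a list \<Rightarrow> bool" where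
  "monochromatic c p \<longleftrightarrow> (\<exists>col. \<forall>e\<in>path_edges p. c e = col)"

definition MC_coloring :: "nat \<Rightarrow> 'a set \<Rightarrow> 'a set set \<Rightarrow> ('a set \<Rightarrow> nat) \<Rightarrow> bool" where
  "MC_coloring k V E c \<longleftrightarrow> (\<forall>u\<in>V. \<forall>v\<in>V. u \<noteq> v \<longrightarrow>
     (\<exists>S. finite S \<and> card S \<ge> k \<and>
        (\<forall>p\<in>S. path_between V E u v p \<and> monochromatic c p) \<and>
        pairwise (\<lambda>p q. disjnt (path_edges p) (path_edges q)) S))"

(* For a finite graph the maximum is over a finite set of numbers; that set is nonempty when
   the graph is k-edge-connected, as one may use a single color. *)
definition mc :: "nat \<Rightarrow> 'a set \<Rightarrow> 'a set set \<Rightarrow> nat" where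
  "mc k V E = Max {card (c ` E) | c. MC_coloring k V E c}"

end

theory Submission
  imports Defs
begin

text \<open>By the tree-packing theorem of Nash-Williams and Tutte, \<open>\<Psi>(G) \<ge> k\<close> yields \<open>k\<close> edge-disjoint
  spanning trees. Coloring the \<open>i\<close>-th tree with color \<open>i\<close> and giving each remaining edge a color of its
  own uses \<open>k + e(G) - k(n - 1)\<close> colors, and any two vertices are joined by a monochromatic path in
  each tree.

  For the tree-packing theorem, take \<open>k\<close> disjoint forests with as many edges as possible, and let \<open>R\<close>
  be the set of edges left uncovered by some packing obtained from them by repeated exchanges. Every
  forest of the packing spans \<open>R\<close> within \<open>R\<close>, so it has \<open>n - s\<close> edges in \<open>R\<close>, where \<open>s\<close> is the number of
  components of \<open>(V, R)\<close>. All of the at least \<open>k(s - 1)\<close> edges between these components are covered,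
  which gives \<open>k(n - 1)\<close> edges in total.\<close>

section \<open>Connectivity and forests\<close>

text \<open>Taken on the whole type, so that it depends on the edge set alone and is an equivalence
  on \<open>UNIV\<close>; vertices without edges are classes of their own.\<close>

definition conn :: "'a set set \<Rightarrow> ('a \<times> 'a) set" where
  "conn F = {(x, y). {x, y} \<in> F}\<^sup>*"

text \<open>Acyclicity stated without cycles: every edge is a bridge. This is the form in which the
  exchange arguments use it.\<close>

definition forest :: "'a set set \<Rightarrow> bool" where
  "forest F \<longleftrightarrow> (\<forall>x y. {x, y} \<in> F \<longrightarrow> (x, y) \<notin> conn (F - {{x, y}}))"

lemma conn_refl [simp]: "(x, x) \<in> conn F"
  by (simp add: conn_def)

lemma conn_edge: "{x, y} \<in> F \<Longrightarrow> (x, y) \<in> conn F"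
  by (auto simp: conn_def)

lemma conn_trans: "(x, y) \<in> conn F \<Longrightarrow> (y, z) \<in> conn F \<Longrightarrow> (x, z) \<in> conn F"
  by (auto simp: conn_def)

lemma conn_sym: "(x, y) \<in> conn F \<Longrightarrow> (y, x) \<in> conn F"
proof -
  have "sym {(x, y). {x, y} \<in> F}"
    by (auto simp: sym_def insert_commute)
  then show "(x, y) \<in> conn F \<Longrightarrow> (y, x) \<in> conn F"
    unfolding conn_def by (meson sym_rtrancl symD)
qed

lemma equiv_conn: "equiv UNIV (conn F)"
  by (intro equivI refl_onI symI transI) (auto intro: conn_sym conn_trans)

lemma conn_mono: "F \<subseteq> G \<Longrightarrow> conn F \<subseteq> conn G"
  unfolding conn_def by (intro rtrancl_mono) auto

lemma conn_least: "(\<And>x y. {x, y} \<in> F \<Longrightarrow> (x, y) \<in> conn G) \<Longrightarrow> conn F \<subseteq> conn G"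
  unfolding conn_def by (intro rtrancl_subset_rtrancl) auto

text \<open>A walk can be shortened so that it crosses the new edge at most once, in one of two
  directions: crossing it back leads to a component reached before.\<close>

lemma conn_insertD:
  assumes "(x, y) \<in> conn (insert {a, b} F)"
  shows "(x, y) \<in> conn F \<or> (x, a) \<in> conn F \<and> (b, y) \<in> conn F
    \<or> (x, b) \<in> conn F \<and> (a, y) \<in> conn F"
  using assms[unfolded conn_def]
proof (induction rule: rtrancl_induct)
  case (step y z)
  then have "(y, z) \<in> conn F \<or> y = a \<and> z = b \<or> y = b \<and> z = a"
    by (auto simp: doubleton_eq_iff intro: conn_edge)
  then show ?case
    using step.IH by (metis conn_refl conn_trans)
qed simp

lemma forest_subset: "forest F \<Longrightarrow> G \<subseteq> F \<Longrightarrow> forest G"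
  unfolding forest_def by (meson Diff_mono conn_mono order_refl subset_iff)

text \<open>A cycle in the enlarged graph would pass through the new edge, and the rest of that
  cycle would connect \<open>a\<close> and \<open>b\<close> inside \<open>F\<close>.\<close>

lemma forest_insert:
  assumes "forest F" "(a, b) \<notin> conn F"
  shows "forest (insert {a, b} F)"
  unfolding forest_def
proof (intro allI impI notI)
  fix x y
  assume xy: "{x, y} \<in> insert {a, b} F" "(x, y) \<in> conn (insert {a, b} F - {{x, y}})"
  show False
  proof (cases "{x, y} = {a, b}")
    case True
    then have "(x, y) \<in> conn F"
      using xy(2) conn_mono[of "insert {a, b} F - {{x, y}}" F] by auto
    then show False
      using True assms(2) conn_sym by (fastforce simp: doubleton_eq_iff)
  next
    case False
    then have F: "{x, y} \<in> F"
      using xy by auto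
    have "insert {a, b} F - {{x, y}} = insert {a, b} (F - {{x, y}})"
      using False by auto
    then have *: "(x, y) \<in> conn (F - {{x, y}}) \<or> (x, a) \<in> conn (F - {{x, y}}) \<and> (b, y) \<in> conn (F - {{x, y}})
        \<or> (x, b) \<in> conn (F - {{x, y}}) \<and> (a, y) \<in> conn (F - {{x, y}})"
      using conn_insertD xy(2) by metis
    moreover have "(x, y) \<notin> conn (F - {{x, y}})"
      using F assms(1) unfolding forest_def by blast
    ultimately have "(x, a) \<in> conn F \<and> (b, y) \<in> conn F \<or> (x, b) \<in> conn F \<and> (a, y) \<in> conn F"
      using conn_mono[of "F - {{x, y}}" F] by blast
    then have "(a, b) \<in> conn F"
      using conn_edge[OF F] by (meson conn_sym conn_trans)
    then show False
      using assms(2) by simp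
  qed
qed

text \<open>The edges of a forest whose removal separates \<open>a\<close> from \<open>b\<close> form the path from \<open>a\<close> to \<open>b\<close>;
  if \<open>{a, b}\<close> is added, they are the other edges of the cycle that arises.\<close>

lemma conn_separating_edges:
  assumes "finite F" "forest F" "\<And>e. e \<in> F \<Longrightarrow> card e = 2" "(a, b) \<in> conn F"
  shows "(a, b) \<in> conn {e \<in> F. (a, b) \<notin> conn (F - {e})}"
proof -
  \<comment> \<open>A smallest connecting set of edges plays the role of the path; each of its edges
    turns out to be separating in \<open>F\<close>.\<close>
  obtain C where C: "C \<subseteq> F" "(a, b) \<in> conn C"
    and min: "\<And>D. D \<subseteq> F \<Longrightarrow> (a, b) \<in> conn D \<Longrightarrow> card C \<le> card D"
    using ex_has_least_nat[of "\<lambda>C. C \<subseteq> F \<and> (a, b) \<in> conn C" F card] assms(4) by auto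
  have "(a, b) \<notin> conn (F - {e})" if e: "e \<in> C" for e
  proof
    assume ab: "(a, b) \<in> conn (F - {e})"
    obtain x y where xy: "e = {x, y}"
      using assms(3) C(1) e by (meson card_2_iff subsetD)
    have "card (C - {e}) < card C"
      using e C(1) assms(1) by (meson card_Diff1_less finite_subset)
    then have "(a, b) \<notin> conn (C - {e})"
      using min[of "C - {e}"] C(1) by force
    moreover have "insert {x, y} (C - {e}) = C"
      using e xy by auto
    ultimately have "(a, x) \<in> conn (C - {e}) \<and> (y, b) \<in> conn (C - {e})
        \<or> (a, y) \<in> conn (C - {e}) \<and> (x, b) \<in> conn (C - {e})"
      using conn_insertD[of a b x y "C - {e}"] C(2) by auto
    then have "(a, x) \<in> conn (F - {e}) \<and> (y, b) \<in> conn (F - {e})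
        \<or> (a, y) \<in> conn (F - {e}) \<and> (x, b) \<in> conn (F - {e})"
      using conn_mono[of "C - {e}" "F - {e}"] C(1) by blast
    \<comment> \<open>The two pieces of \<open>C\<close> left after removing \<open>e\<close>,
      together with a detour from \<open>a\<close> to \<open>b\<close> avoiding \<open>e\<close>,
      close a cycle through \<open>e\<close>.\<close>
    then have "(x, y) \<in> conn (F - {e})"
      using ab by (meson conn_sym conn_trans)
    then show False
      using assms(2) e C(1) xy unfolding forest_def by blast
  qed
  then have "conn C \<subseteq> conn {e \<in> F. (a, b) \<notin> conn (F - {e})}"
    using C(1) by (intro conn_mono) auto
  then show ?thesis
    using C(2) by blast
qed

text \<open>Every connection from \<open>a\<close> to \<open>b\<close> in \<open>G\<close> uses
  \<open>{x, y}\<close>, so without it \<open>a\<close> is still joined to one end and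
  \<open>b\<close> to the other. The new edge \<open>{a, b}\<close> thus reconnects \<open>x\<close>
  and \<open>y\<close>.\<close>

lemma conn_exchange:
  assumes "(a, b) \<in> conn G" "{x, y} \<in> G" "(a, b) \<notin> conn (G - {{x, y}})"
  shows "conn (insert {a, b} (G - {{x, y}})) = conn G"
proof
  let ?H = "insert {a, b} (G - {{x, y}})"
  show "conn ?H \<subseteq> conn G"
  proof (rule conn_least)
    fix u v assume "{u, v} \<in> ?H"
    then show "(u, v) \<in> conn G"
      using assms(1) conn_sym[OF assms(1)] by (auto simp: doubleton_eq_iff intro: conn_edge)
  qed
  have "insert {x, y} (G - {{x, y}}) = G"
    using assms(2) by auto
  then have "(a, x) \<in> conn (G - {{x, y}}) \<and> (y, b) \<in> conn (G - {{x, y}})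
      \<or> (a, y) \<in> conn (G - {{x, y}}) \<and> (x, b) \<in> conn (G - {{x, y}})"
    using conn_insertD[of a b x y "G - {{x, y}}"] assms by auto
  then have "(a, x) \<in> conn ?H \<and> (y, b) \<in> conn ?H \<or> (a, y) \<in> conn ?H \<and> (x, b) \<in> conn ?H"
    using conn_mono[of "G - {{x, y}}" ?H] by blast
  moreover have "(a, b) \<in> conn ?H"
    by (rule conn_edge) simp
  ultimately have xy: "(x, y) \<in> conn ?H"
    by (meson conn_sym conn_trans)
  show "conn G \<subseteq> conn ?H"
  proof (rule conn_least)
    fix u v assume "{u, v} \<in> G"
    then show "(u, v) \<in> conn ?H"
      using xy conn_sym[OF xy] by (cases "{u, v} = {x, y}") (auto simp: doubleton_eq_iff intro: conn_edge)
  qed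
qed

section \<open>Components as a partition of the vertices, and the edge count of a forest\<close>

lemma conn_closed:
  assumes "\<Union> F \<subseteq> V" "(x, y) \<in> conn F" "x \<in> V"
  shows "y \<in> V"
  using assms(2)[unfolded conn_def] assms(1,3) by (induction rule: rtrancl_induct) auto

lemma conn_class_eq: "conn F `` {x} = conn F `` {y} \<longleftrightarrow> (x, y) \<in> conn F"
  using eq_equiv_class_iff[OF equiv_conn] by simp

lemma partition_on_components:
  assumes "\<Union> F \<subseteq> V"
  shows "partition_on V (V // conn F)"
proof (rule partition_onI)
  show "\<Union> (V // conn F) = V"
  proof
    show "\<Union> (V // conn F) \<subseteq> V"
      using conn_closed[OF assms] by (auto simp: quotient_def)
    show "V \<subseteq> \<Union> (V // conn F)"
    proof
      fix x assume "x \<in> V"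
      then have "conn F `` {x} \<in> V // conn F"
        by (rule quotientI)
      then show "x \<in> \<Union> (V // conn F)"
        by (rule UnionI) simp
    qed
  qed
  show "disjnt p q" if pq: "p \<in> V // conn F" "q \<in> V // conn F" "p \<noteq> q" for p q
  proof -
    have "p \<in> UNIV // conn F" "q \<in> UNIV // conn F"
      using pq(1,2) by (auto simp: quotient_def)
    then show ?thesis
      using quotient_disj[OF equiv_conn] pq(3) unfolding disjnt_def by blast
  qed
  show "{} \<notin> V // conn F"
  proof
    assume "{} \<in> V // conn F"
    then obtain x where "conn F `` {x} = {}"
      unfolding quotient_def by blast
    moreover have "x \<in> conn F `` {x}"
      by simp
    ultimately show False
      by blast
  qed
qed

lemma components_insert:
  assumes "finite V" "a \<in> V" "b \<in> V" "(a, b) \<notin> conn F"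
  shows "card (V // conn F) = Suc (card (V // conn (insert {a, b} F)))"
proof -
  let ?c = "\<lambda>x. conn F `` {x}" and ?d = "\<lambda>x. conn (insert {a, b} F) `` {x}"
  have old: "conn F \<subseteq> conn (insert {a, b} F)"
    by (rule conn_mono) auto
  have ab: "(a, b) \<in> conn (insert {a, b} F)"
    by (rule conn_edge) simp
  define A where "A = V // conn F - {?c b}"
  \<comment> \<open>Every component of the larger graph is represented by exactly one old component other
    than that of \<open>b\<close>.\<close>
  have "bij_betw (\<lambda>X. conn (insert {a, b} F) `` X) A (V // conn (insert {a, b} F))"
  proof (rule bij_betw_imageI)
    have img: "conn (insert {a, b} F) `` (?c x) = ?d x" for x
      using old by (auto intro: conn_trans)
    show "inj_on (\<lambda>X. conn (insert {a, b} F) `` X) A"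
    proof (rule inj_onI)
      fix X Y assume X: "X \<in> A" and Y: "Y \<in> A"
        and eq: "conn (insert {a, b} F) `` X = conn (insert {a, b} F) `` Y"
      obtain x y where xy: "X = ?c x" "Y = ?c y"
        using X Y unfolding A_def quotient_def by blast
      have "(x, y) \<in> conn (insert {a, b} F)"
        using eq unfolding xy img conn_class_eq .
      moreover have "(x, b) \<notin> conn F" "(y, b) \<notin> conn F"
        using X Y unfolding A_def xy by (simp_all add: conn_class_eq)
      ultimately have "(x, y) \<in> conn F"
        using conn_insertD conn_sym by metis
      then show "X = Y"
        by (simp add: xy conn_class_eq)
    qed
    show "(\<lambda>X. conn (insert {a, b} F) `` X) ` A = V // conn (insert {a, b} F)"
    proof (intro equalityI subsetI)
      fix Z assume "Z \<in> (\<lambda>X. conn (insert {a, b} F) `` X) ` A"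
      then show "Z \<in> V // conn (insert {a, b} F)"
        unfolding A_def quotient_def by (auto simp: img)
    next
      fix Z assume "Z \<in> V // conn (insert {a, b} F)"
      then obtain z where z: "z \<in> V" "Z = ?d z"
        unfolding quotient_def by blast
      \<comment> \<open>The class of \<open>b\<close> was left out of \<open>A\<close>, so points of
        that class are represented by \<open>a\<close>, which the new edge joins to them.\<close>
      define w where "w = (if (z, b) \<in> conn F then a else z)"
      have "(w, z) \<in> conn (insert {a, b} F)"
        using old ab unfolding w_def by (auto intro: conn_trans conn_sym)
      then have "Z = conn (insert {a, b} F) `` (?c w)"
        unfolding img z(2) conn_class_eq by (rule conn_sym)
      moreover have "?c w \<in> A"
        using assms z(1) quotientI[of w V "conn F"] unfolding A_def w_def
        by (auto simp: conn_class_eq)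
      ultimately show "Z \<in> (\<lambda>X. conn (insert {a, b} F) `` X) ` A"
        by blast
    qed
  qed
  then have "card (V // conn (insert {a, b} F)) = card A"
    by (simp add: bij_betw_same_card)
  moreover have "?c b \<in> V // conn F" "finite (V // conn F)"
    using assms by (auto simp: quotient_def)
  ultimately show ?thesis
    unfolding A_def by (metis card_Suc_Diff1)
qed

text \<open>Edges are added one at a time to isolated vertices. Each is a bridge, so it merges two
  components and lowers their number by one.\<close>

lemma forest_card:
  assumes "finite V" "simple_graph V F" "forest F"
  shows "card F + card (V // conn F) = card V"
proof -
  have "F \<subseteq> Pow V"
    using assms(2) unfolding simple_graph_def by auto
  then have "finite F"
    using assms(1) by (meson finite_Pow_iff finite_subset)
  then show ?thesis
    using assms(2,3)
  proof (induction F rule: finite_induct)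
    case empty
    have "V // conn {} = (\<lambda>x. {x}) ` V"
      by (auto simp: quotient_def conn_def)
    then show ?case
      by (simp add: card_image)
  next
    case (insert e F)
    obtain a b where ab: "e = {a, b}" "a \<in> V" "b \<in> V"
      using insert.prems(1) unfolding simple_graph_def by (metis card_2_iff insert_subset insertI1)
    have "insert e F - {e} = F"
      using insert.hyps by auto
    then have "(a, b) \<notin> conn F"
      using insert.prems(2) ab unfolding forest_def by (metis insertI1)
    then have "card (V // conn F) = Suc (card (V // conn (insert e F)))"
      using components_insert assms(1) ab by metis
    moreover have "card F + card (V // conn F) = card V"
      using insert.prems forest_subset[of "insert e F" F]
      by (intro insert.IH) (auto simp: simple_graph_def)
    ultimately show ?case
      using insert.hyps by simp
  qed
qed

section \<open>Simple paths from connectivity\<close>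

lemma conn_imp_path:
  assumes "(u, v) \<in> conn F" "F \<subseteq> E" "\<Union> E \<subseteq> V" "v \<in> V"
  shows "\<exists>p. path_between V E u v p \<and> path_edges p \<subseteq> F"
  using assms(1)[unfolded conn_def]
proof (induction rule: converse_rtrancl_induct)
  case base
  have "path_between V E v v [v]" "path_edges [v] = {}"
    using assms(4) by (simp_all add: path_between_def path_edges_def)
  then show ?case
    by (metis empty_subsetI)
next
  case (step u w)
  then obtain p where p: "path_between V E w v p" "path_edges p \<subseteq> F"
    by blast
  have uw: "{u, w} \<in> F"
    using step.hyps by simp
  show ?case
  proof (cases "u \<in> set p")
    \<comment> \<open>The path grows backwards from \<open>v\<close>. If the new start already lies
      on it, the suffix from that vertex on remains simple.\<close>
    case True
    then obtain xs ys where split: "p = xs @ u # ys"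
      by (meson split_list)
    have "path_edges (u # ys) \<subseteq> path_edges p"
    proof
      fix e assume "e \<in> path_edges (u # ys)"
      then obtain i where i: "e = {(u # ys) ! i, (u # ys) ! Suc i}" "Suc i < length (u # ys)"
        unfolding path_edges_def by blast
      have "p ! (length xs + j) = (u # ys) ! j" for j
        by (simp add: split nth_append)
      from this[of i] this[of "Suc i"]
      have "e = {p ! (length xs + i), p ! Suc (length xs + i)}" "Suc (length xs + i) < length p"
        using i by (simp_all add: split)
      then show "e \<in> path_edges p"
        unfolding path_edges_def by blast
    qed
    moreover from this have "path_between V E u v (u # ys)"
      using p(1) unfolding path_between_def split by auto
    ultimately show ?thesis
      using p(2) by blast
  next
    case False
    have "path_edges (u # p) \<subseteq> insert {u, w} (path_edges p)"
    proof
      fix e assume "e \<in> path_edges (u # p)"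
      then obtain i where i: "e = {(u # p) ! i, (u # p) ! Suc i}" "Suc i < length (u # p)"
        unfolding path_edges_def by blast
      show "e \<in> insert {u, w} (path_edges p)"
      proof (cases i)
        case 0
        then show ?thesis
          using i p(1) by (auto simp: path_between_def hd_conv_nth)
      next
        case (Suc j)
        then show ?thesis
          using i unfolding path_edges_def by auto
      qed
    qed
    then have sub: "path_edges (u # p) \<subseteq> F"
      using p(2) uw by auto
    moreover have "path_between V E u v (u # p)"
      using p(1) sub uw False assms(2,3) unfolding path_between_def by auto
    ultimately show ?thesis
      by blast
  qed
qed

section \<open>Tree packing\<close>

definition forest_packing :: "nat \<Rightarrow> 'a set set \<Rightarrow> (nat \<Rightarrow> 'a set set) \<Rightarrow> bool" where
  "forest_packing k E T \<longleftrightarrow> (\<forall>i<k. T i \<subseteq> E \<and> forest (T i)) \<and> disjoint_family_on T {..<k}"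

definition packing_size :: "nat \<Rightarrow> (nat \<Rightarrow> 'a set set) \<Rightarrow> nat" where
  "packing_size k T = (\<Sum>i<k. card (T i))"

definition uncovered :: "nat \<Rightarrow> 'a set set \<Rightarrow> (nat \<Rightarrow> 'a set set) \<Rightarrow> 'a set set" where
  "uncovered k E T = E - (\<Union>i<k. T i)"

text \<open>An uncovered edge enters \<open>T i\<close> and an edge of the path in
  \<open>T i\<close> between its ends leaves; lying on that path is expressed by separating
  \<open>a\<close> from \<open>b\<close>.\<close>

definition exchange :: "nat \<Rightarrow> 'a set set \<Rightarrow> ((nat \<Rightarrow> 'a set set) \<times> (nat \<Rightarrow> 'a set set)) set" where
  "exchange k E = {(T, T'). \<exists>i a b x y. i < k \<and> {a, b} \<in> uncovered k E T \<and> (a, b) \<in> conn (T i)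
     \<and> {x, y} \<in> T i \<and> (a, b) \<notin> conn (T i - {{x, y}})
     \<and> T' = T(i := insert {a, b} (T i - {{x, y}}))}"

text \<open>Serves two purposes: \<open>G = T i\<close> enlarges the packing, and \<open>T i\<close>
  minus one edge gives an exchange.\<close>

lemma forest_packing_update:
  assumes "forest_packing k E T" "i < k" "{a, b} \<in> uncovered k E T"
    "G \<subseteq> T i" "(a, b) \<notin> conn G"
  shows "forest_packing k E (T(i := insert {a, b} G))"
  unfolding forest_packing_def
proof (intro conjI allI impI)
  fix j assume "j < k"
  then show "(T(i := insert {a, b} G)) j \<subseteq> E" "forest ((T(i := insert {a, b} G)) j)"
    using assms forest_insert[of G a b] forest_subset[of "T i" G]
    by (auto simp: forest_packing_def uncovered_def)
next
  have disj: "T m \<inter> T n = {}" if "m < k" "n < k" "m \<noteq> n" for m n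
    using assms(1) that by (auto simp: forest_packing_def disjoint_family_on_def)
  have "insert {a, b} G \<inter> T j = {}" if "j < k" "j \<noteq> i" for j
    using disj[of i j] that assms(2-4) unfolding uncovered_def by auto
  with disj show "disjoint_family_on (T(i := insert {a, b} G)) {..<k}"
    by (auto simp: disjoint_family_on_def)
qed

lemma packing_size_update:
  assumes "i < k"
  shows "packing_size k (T(i := G)) + card (T i) = packing_size k T + card G"
proof -
  have "(\<Sum>j\<in>{..<k} - {i}. card ((T(i := G)) j)) = (\<Sum>j\<in>{..<k} - {i}. card (T j))"
    by (rule sum.cong) auto
  then show ?thesis
    using assms unfolding packing_size_def by (simp add: sum.remove[of "{..<k}" i])
qed

lemma exchange_packing:
  assumes "finite E" "forest_packing k E T" "(T, T') \<in> exchange k E"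
  shows "forest_packing k E T'" "packing_size k T' = packing_size k T"
proof -
  obtain i a b x y where i: "i < k" and ab: "{a, b} \<in> uncovered k E T"
    and xy: "{x, y} \<in> T i" "(a, b) \<notin> conn (T i - {{x, y}})"
    and T': "T' = T(i := insert {a, b} (T i - {{x, y}}))"
    using assms(3) unfolding exchange_def by blast
  show "forest_packing k E T'"
    unfolding T' by (rule forest_packing_update[OF assms(2) i ab _ xy(2)]) auto
  have "finite (T i)"
    using assms(1,2) i finite_subset unfolding forest_packing_def by blast
  moreover have "{a, b} \<notin> T i"
    using ab i unfolding uncovered_def by auto
  ultimately have "card (insert {a, b} (T i - {{x, y}})) = card (T i)"
    using xy(1) card_Suc_Diff1[of "T i" "{x, y}"] by simp
  then show "packing_size k T' = packing_size k T"
    using packing_size_update[OF i, of T "insert {a, b} (T i - {{x, y}})"] unfolding T' by simp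
qed

section \<open>Packings with the largest number of edges\<close>

lemma maximal_packing_exists:
  assumes "finite E"
  obtains T where "forest_packing k E T"
    "\<And>T'. forest_packing k E T' \<Longrightarrow> packing_size k T' \<le> packing_size k T"
proof -
  have "forest_packing k E (\<lambda>_. {})"
    by (simp add: forest_packing_def forest_def disjoint_family_on_def)
  moreover have "packing_size k T < Suc (k * card E)" if "forest_packing k E T" for T
  proof -
    have "packing_size k T \<le> (\<Sum>i<k. card E)"
      using that assms unfolding packing_size_def forest_packing_def
      by (intro sum_mono card_mono) auto
    then show ?thesis
      by simp
  qed
  ultimately show thesis
    using ex_has_greatest_nat[of "forest_packing k E" "\<lambda>_. {}" "packing_size k" "Suc (k * card E)"]
      that by blast
qed

text \<open>Otherwise \<open>{a, b}\<close> could be added to \<open>T i\<close>, giving a larger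
  packing.\<close>

lemma maximal_packing_spans:
  assumes "finite E" "forest_packing k E T"
    and max: "\<And>T'. forest_packing k E T' \<Longrightarrow> packing_size k T' \<le> packing_size k T"
    and "i < k" "{a, b} \<in> uncovered k E T"
  shows "(a, b) \<in> conn (T i)"
proof (rule ccontr)
  assume ab: "(a, b) \<notin> conn (T i)"
  have "finite (T i)"
    using assms(1,2,4) finite_subset unfolding forest_packing_def by blast
  moreover have "{a, b} \<notin> T i"
    using assms(4,5) unfolding uncovered_def by auto
  ultimately have "packing_size k (T(i := insert {a, b} (T i))) = Suc (packing_size k T)"
    using packing_size_update[OF assms(4), of T "insert {a, b} (T i)"] by simp
  moreover have "forest_packing k E (T(i := insert {a, b} (T i)))"
    by (rule forest_packing_update[OF assms(2,4,5) order_refl ab])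
  ultimately show False
    using max by fastforce
qed

text \<open>An exchange does not affect the components of \<open>T i \<inter> R\<close>, and an edge of \<open>R\<close> is
  spanned by \<open>T' i \<inter> R\<close> for the packing \<open>T'\<close> leaving it uncovered; hence it is also spanned
  by \<open>T i \<inter> R\<close>.\<close>

lemma maximal_packing_core:
  assumes E: "finite E" "\<And>e. e \<in> E \<Longrightarrow> card e = 2" and T: "forest_packing k E T"
    and max: "\<And>T'. forest_packing k E T' \<Longrightarrow> packing_size k T' \<le> packing_size k T"
  obtains R where "uncovered k E T \<subseteq> R" "R \<subseteq> E" "\<And>i. i < k \<Longrightarrow> conn (T i \<inter> R) = conn R"
proof -
  define R where "R = (\<Union>T' \<in> (exchange k E)\<^sup>* `` {T}. uncovered k E T')"
  have reach: "forest_packing k E T' \<and> packing_size k T' = packing_size k T"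
    if "(T, T') \<in> (exchange k E)\<^sup>*" for T'
    using that
  proof (induction rule: rtrancl_induct)
    case (step T' T'')
    then show ?case
      using exchange_packing[OF E(1)] by metis
  qed (simp add: T)
  have spans: "(a, b) \<in> conn (T' i \<inter> R)"
    if T': "(T, T') \<in> (exchange k E)\<^sup>*" and i: "i < k" and ab: "{a, b} \<in> uncovered k E T'" for T' i a b
  proof -
    have pack: "forest_packing k E T'"
      using reach[OF T'] by simp
    have ab': "(a, b) \<in> conn (T' i)"
      using maximal_packing_spans[OF E(1) pack _ i ab] reach[OF T'] max by simp
    have sub: "T' i \<subseteq> E" "forest (T' i)"
      using pack i unfolding forest_packing_def by auto
    \<comment> \<open>Each edge on the path between \<open>a\<close> and \<open>b\<close> in
      \<open>T' i\<close> can be exchanged for \<open>{a, b}\<close>. The resulting packing is again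
      reachable and leaves that edge uncovered.\<close>
    have "e \<in> R" if e: "e \<in> T' i" "(a, b) \<notin> conn (T' i - {e})" for e
    proof -
      obtain x y where xy: "e = {x, y}"
        using e(1) sub(1) E(2) by (meson card_2_iff subsetD)
      define T'' where "T'' = T'(i := insert {a, b} (T' i - {{x, y}}))"
      have "(T', T'') \<in> exchange k E"
        unfolding exchange_def T''_def using i ab ab' e xy by blast
      then have "(T, T'') \<in> (exchange k E)\<^sup>*"
        using T' by simp
      moreover have "e \<in> uncovered k E T''"
      proof -
        have "e \<noteq> {a, b}"
          using e(1) ab i unfolding uncovered_def by auto
        moreover have "e \<notin> T' j" if "j < k" "j \<noteq> i" for j
          using pack e(1) i that unfolding forest_packing_def disjoint_family_on_def by blast
        ultimately show ?thesis
          using e(1) sub(1) xy unfolding uncovered_def T''_def by auto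
      qed
      ultimately show ?thesis
        unfolding R_def by blast
    qed
    then have "{e \<in> T' i. (a, b) \<notin> conn (T' i - {e})} \<subseteq> T' i \<inter> R"
      by blast
    then show ?thesis
      using conn_separating_edges[OF _ sub(2) _ ab'] sub(1) E conn_mono finite_subset
      by (metis (no_types, lifting) subsetD)
  qed
  have invariant: "conn (T' i \<inter> R) = conn (T i \<inter> R)"
    if "(T, T') \<in> (exchange k E)\<^sup>*" "i < k" for T' i
    using that
  proof (induction rule: rtrancl_induct)
    case (step T' T'')
    obtain j a b x y where j: "j < k" and ab: "{a, b} \<in> uncovered k E T'"
      and xy: "{x, y} \<in> T' j" "(a, b) \<notin> conn (T' j - {{x, y}})"
      and T'': "T'' = T'(j := insert {a, b} (T' j - {{x, y}}))"
      using step.hyps(2) unfolding exchange_def by blast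
    have "conn (T'' i \<inter> R) = conn (T' i \<inter> R)"
    proof (cases "i = j")
      case True
      have abR: "{a, b} \<in> R" and conn: "(a, b) \<in> conn (T' i \<inter> R)"
        using ab step.hyps(1) spans step.prems unfolding R_def by blast+
      have cut: "(a, b) \<notin> conn (T' i \<inter> R - {{x, y}})"
        using xy(2) conn_mono[of "T' i \<inter> R - {{x, y}}" "T' j - {{x, y}}"] True by blast
      \<comment> \<open>If the leaving edge were outside \<open>R\<close>, the connection of
        \<open>a\<close> and \<open>b\<close> inside \<open>R\<close> would survive its
        removal.\<close>
      have "{x, y} \<in> T' i \<inter> R"
        by (rule ccontr) (use conn cut in simp)
      moreover have "T'' i \<inter> R = insert {a, b} (T' i \<inter> R - {{x, y}})"
        using abR True unfolding T'' by auto
      ultimately show ?thesis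
        using conn_exchange[OF conn _ cut] by simp
    qed (simp add: T'')
    then show ?case
      using step by simp
  qed simp
  show thesis
  proof
    show "uncovered k E T \<subseteq> R"
      unfolding R_def by blast
    show "R \<subseteq> E"
      unfolding R_def uncovered_def by blast
    show "conn (T i \<inter> R) = conn R" if i: "i < k" for i
    proof
      show "conn (T i \<inter> R) \<subseteq> conn R"
        by (rule conn_mono) auto
      show "conn R \<subseteq> conn (T i \<inter> R)"
      proof (rule conn_least)
        fix a b assume "{a, b} \<in> R"
        then obtain T' where "(T, T') \<in> (exchange k E)\<^sup>*" "{a, b} \<in> uncovered k E T'"
          unfolding R_def by blast
        then show "(a, b) \<in> conn (T i \<inter> R)"
          using spans invariant i by blast
      qed
    qed
  qed
qed

section \<open>From a maximal packing to spanning trees\<close>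

lemma simple_graph_subset: "simple_graph V E \<Longrightarrow> F \<subseteq> E \<Longrightarrow> simple_graph V F"
  unfolding simple_graph_def by blast

lemma simple_graph_finite_edges:
  assumes "simple_graph V E"
  shows "finite E"
proof -
  have "E \<subseteq> Pow V" "finite V"
    using assms unfolding simple_graph_def by auto
  then show ?thesis
    by (meson finite_Pow_iff finite_subset)
qed

text \<open>The counting squeezes every forest: the total is at least
  \<open>k * (card V - 1)\<close>, while each forest has at most \<open>card V - 1\<close> edges.
  Equality leaves a single component. For one part the truncated difference in \<open>dense\<close>
  is 0, which covers the case that \<open>R\<close> connects \<open>V\<close>.\<close>

theorem tree_packing:
  assumes G: "simple_graph V E" "V \<noteq> {}"
    and dense: "\<And>P. partition_on V P \<Longrightarrow> k * (card P - 1) \<le> card (quotient_edges E P)"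
  obtains T where "forest_packing k E T" "\<And>i. i < k \<Longrightarrow> Suc (card (T i)) = card V"
    "\<And>i u v. i < k \<Longrightarrow> u \<in> V \<Longrightarrow> v \<in> V \<Longrightarrow> (u, v) \<in> conn (T i)"
proof -
  have V: "finite V" and E: "finite E" "\<And>e. e \<in> E \<Longrightarrow> card e = 2" "\<Union> E \<subseteq> V"
    using G(1) simple_graph_finite_edges[OF G(1)] by (auto simp: simple_graph_def)
  obtain T where T: "forest_packing k E T"
    and max: "\<And>T'. forest_packing k E T' \<Longrightarrow> packing_size k T' \<le> packing_size k T"
    using maximal_packing_exists[OF E(1)] by blast
  obtain R where R: "uncovered k E T \<subseteq> R" "R \<subseteq> E" "\<And>i. i < k \<Longrightarrow> conn (T i \<inter> R) = conn R"
    using maximal_packing_core[OF E(1,2) T max] by blast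
  define P where "P = V // conn R"
  define Q where "Q = quotient_edges E P"
  have part: "partition_on V P"
    unfolding P_def by (rule partition_on_components) (use R(2) E(3) in auto)
  have pos: "card (V // r) > 0" for r
    using G(2) V by (simp add: card_gt_0_iff finite_quotient) (auto simp: quotient_def)
  have T_i: "T i \<subseteq> E" "forest (T i)" if "i < k" for i
    using T that unfolding forest_packing_def by auto
  have tree: "card (T i) + card (V // conn (T i)) = card V" if "i < k" for i
    using forest_card[OF V simple_graph_subset[OF G(1)]] T_i[OF that] by blast
  \<comment> \<open>An edge of \<open>R\<close> lies within one component, so every edge between
    different parts is covered by the packing.\<close>
  have QR: "Q \<inter> R = {}"
  proof (rule ccontr)
    assume "Q \<inter> R \<noteq> {}"
    then obtain e where e: "e \<in> Q" "e \<in> R"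
      by blast
    then obtain x y where xy: "e = {x, y}"
      using R(2) E(2) by (meson card_2_iff subsetD)
    have "x \<in> V"
      using xy e(2) R(2) E(3) by auto
    then have "e \<subseteq> conn R `` {x}" "conn R `` {x} \<in> P"
      using xy e(2) conn_edge unfolding P_def by (auto intro: quotientI)
    then show False
      using e(1) unfolding Q_def quotient_edges_def by blast
  qed
  then have "Q \<subseteq> (\<Union>i<k. Q \<inter> T i)"
    using R(1) unfolding Q_def quotient_edges_def uncovered_def by blast
  moreover have finT: "finite (T i)" if "i < k" for i
    using E(1) T_i(1)[OF that] finite_subset by blast
  ultimately have "card Q \<le> card (\<Union>i<k. Q \<inter> T i)"
    by (intro card_mono) auto
  also have "\<dots> \<le> (\<Sum>i<k. card (Q \<inter> T i))"
    by (rule card_UN_le) simp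
  finally have Q: "k * (card P - 1) \<le> (\<Sum>i<k. card (Q \<inter> T i))"
    using dense[OF part] unfolding Q_def by simp
  \<comment> \<open>The edges of \<open>T i\<close> in \<open>R\<close> and those between parts are
    disjoint. The former form a forest with the components of \<open>R\<close>, so they number
    \<open>card V - card P\<close>.\<close>
  have "card V - card P + card (Q \<inter> T i) \<le> card (T i)" if i: "i < k" for i
  proof -
    have "card (T i \<inter> R) + card P = card V"
      using forest_card[OF V simple_graph_subset[OF G(1)], of "T i \<inter> R"] T_i[OF i]
        forest_subset[of "T i" "T i \<inter> R"] R(3)[OF i] unfolding P_def by auto
    moreover have "card (T i \<inter> R) + card (Q \<inter> T i) = card (T i \<inter> R \<union> Q \<inter> T i)"
      using QR finT[OF i] by (intro card_Un_disjoint[symmetric]) auto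
    moreover have "card (T i \<inter> R \<union> Q \<inter> T i) \<le> card (T i)"
      using finT[OF i] by (intro card_mono) auto
    ultimately show ?thesis
      by linarith
  qed
  then have "(\<Sum>i<k. card V - card P + card (Q \<inter> T i)) \<le> (\<Sum>i<k. card (T i))"
    by (intro sum_mono) simp
  then have "k * (card V - card P) + k * (card P - 1) \<le> (\<Sum>i<k. card (T i))"
    using Q by (simp add: sum.distrib)
  moreover have "card P \<le> card V" "card P > 0"
    using V pos unfolding P_def quotient_def
    by (auto intro!: order_trans[OF card_UN_le] simp: card_image_le)
  then have "(card V - card P) + (card P - 1) = card V - 1"
    by simp
  ultimately have ge: "k * (card V - 1) \<le> (\<Sum>i<k. card (T i))"
    by (metis distrib_left)
  have le: "card (T i) \<le> card V - 1" if "i < k" for i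
    using tree[OF that] pos[of "conn (T i)"] by linarith
  have eq: "card (T i) = card V - 1" if i: "i < k" for i
  proof (rule ccontr)
    assume "card (T i) \<noteq> card V - 1"
    then have "(\<Sum>i<k. card (T i)) < (\<Sum>i<k. card V - 1)"
      using le i by (intro sum_strict_mono_ex1) (auto intro!: bexI[of _ i] simp: order_less_le)
    then show False
      using ge by simp
  qed
  have card_V: "card V > 0"
    using G(2) V by (simp add: card_gt_0_iff)
  show thesis
  proof
    show "forest_packing k E T"
      by (rule T)
    show "Suc (card (T i)) = card V" if "i < k" for i
      using eq[OF that] card_V by simp
    show "(u, v) \<in> conn (T i)" if i: "i < k" and uv: "u \<in> V" "v \<in> V" for i u v
    proof -
      have "card (V // conn (T i)) = 1"
        using tree[OF i] eq[OF i] card_V by linarith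
      moreover have "conn (T i) `` {u} \<in> V // conn (T i)" "conn (T i) `` {v} \<in> V // conn (T i)"
        using uv by (auto simp: quotient_def)
      ultimately have "conn (T i) `` {u} = conn (T i) `` {v}"
        by (metis card_1_singletonE singletonD)
      then show ?thesis
        by (simp add: conn_class_eq)
    qed
  qed
qed

section \<open>The coloring\<close>

lemma Psi_le_quotient:
  assumes "finite V" "Psi V E \<ge> int k" "partition_on V P"
  shows "k * (card P - 1) \<le> card (quotient_edges E P)"
\<comment> \<open>With fewer than two parts \<open>psi\<close> says nothing, but then
  \<open>card P - 1\<close> is 0.\<close>
proof (cases "card P \<ge> 2")
  case True
  let ?S = "{real (card (quotient_edges E P)) / (real (card P) - 1) | P.
     partition_on V P \<and> card P \<ge> 2}"
  have "?S \<subseteq> (\<lambda>P. real (card (quotient_edges E P)) / (real (card P) - 1)) ` {P. partition_on V P}"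
    by blast
  then have "finite ?S"
    using finitely_many_partition_on[OF assms(1)] finite_surj by blast
  then have "psi V E \<le> real (card (quotient_edges E P)) / (real (card P) - 1)"
    unfolding psi_def by (rule Min_le) (use True assms(3) in blast)
  moreover have "real k \<le> psi V E"
    using assms(2) unfolding Psi_def by (simp add: le_floor_iff)
  ultimately have "real k \<le> real (card (quotient_edges E P)) / (real (card P) - 1)"
    by (rule order_trans[rotated])
  then have "real k * (real (card P) - 1) \<le> real (card (quotient_edges E P))"
    using True by (simp add: pos_le_divide_eq)
  then have "real (k * (card P - 1)) \<le> real (card (quotient_edges E P))"
    using True by (simp add: of_nat_diff)
  then show ?thesis
    by (simp only: of_nat_le_iff)
qed simp

text \<open>There are infinitely many functions \<open>c\<close>, but their color counts are bounded
  by \<open>card E\<close>, so the maximum is attained over a finite set.\<close>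

lemma mc_ge:
  assumes "finite E" "MC_coloring k V E c"
  shows "card (c ` E) \<le> mc k V E"
proof -
  have "{card (c ` E) | c. MC_coloring k V E c} \<subseteq> {..card E}"
    using card_image_le[OF assms(1)] by auto
  then have "finite {card (c ` E) | c. MC_coloring k V E c}"
    using finite_subset by blast
  then show ?thesis
    unfolding mc_def by (rule Max_ge) (use assms(2) in blast)
qed

lemma MC_coloring_of_packing:
  assumes "\<Union> E \<subseteq> V" "forest_packing k E T"
    and span: "\<And>i u v. i < k \<Longrightarrow> u \<in> V \<Longrightarrow> v \<in> V \<Longrightarrow> (u, v) \<in> conn (T i)"
    and color: "\<And>i e. i < k \<Longrightarrow> e \<in> T i \<Longrightarrow> c e = i"
  shows "MC_coloring k V E c"
  unfolding MC_coloring_def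
proof (intro ballI impI)
  fix u v assume uv: "u \<in> V" "v \<in> V" "u \<noteq> v"
  have "\<exists>p. path_between V E u v p \<and> path_edges p \<subseteq> T i" if "i < k" for i
    using conn_imp_path[OF span[OF that uv(1,2)] _ assms(1) uv(2)] assms(2) that
    unfolding forest_packing_def by blast
  then obtain p where p: "\<And>i. i < k \<Longrightarrow> path_between V E u v (p i) \<and> path_edges (p i) \<subseteq> T i"
    by metis
  \<comment> \<open>Disjoint edge sets force the \<open>k\<close> paths to be distinct only because
    no path is trivial, which follows from \<open>u\<close> and \<open>v\<close> being
    different.\<close>
  have nonempty: "path_edges (p i) \<noteq> {}" if "i < k" for i
  proof -
    have "p i \<noteq> []" "hd (p i) \<noteq> last (p i)"
      using p[OF that] uv(3) unfolding path_between_def by auto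
    then have "Suc 0 < length (p i)"
      by (cases "p i") (auto split: if_splits)
    then show ?thesis
      unfolding path_edges_def by blast
  qed
  have disj: "disjnt (path_edges (p i)) (path_edges (p j))" if "i < k" "j < k" "i \<noteq> j" for i j
    using p that assms(2) unfolding forest_packing_def disjoint_family_on_def disjnt_def by blast
  then have "inj_on p {..<k}"
    using nonempty by (intro inj_onI) (metis disjnt_self_iff_empty lessThan_iff)
  then have "card (p ` {..<k}) = k"
    by (simp add: card_image)
  moreover have "pairwise (\<lambda>p q. disjnt (path_edges p) (path_edges q)) (p ` {..<k})"
    using disj by (auto simp: pairwise_def)
  moreover have "path_between V E u v (p i) \<and> monochromatic c (p i)" if "i < k" for i
    using p[OF that] color[OF that] unfolding monochromatic_def by blast
  ultimately show "\<exists>S. finite S \<and> card S \<ge> k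
      \<and> (\<forall>p\<in>S. path_between V E u v p \<and> monochromatic c p)
      \<and> pairwise (\<lambda>p q. disjnt (path_edges p) (path_edges q)) S"
    by (intro exI[of _ "p ` {..<k}"]) auto
qed

lemma packing_coloring_exists:
  assumes "finite E" "forest_packing k E T" "\<And>i. i < k \<Longrightarrow> T i \<noteq> {}"
  obtains c :: "'a set \<Rightarrow> nat" where "\<And>i e. i < k \<Longrightarrow> e \<in> T i \<Longrightarrow> c e = i"
    "k + card E \<le> card (c ` E) + packing_size k T"
proof -
  obtain h :: "'a set \<Rightarrow> nat" where h: "inj_on h E"
    using finite_imp_inj_to_nat_seg[OF assms(1)] by blast
  \<comment> \<open>Disjointness of the forests makes the index unique. The shift by
    \<open>k\<close> keeps the colors of the uncovered edges apart from the tree colors, and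
    \<open>h\<close> keeps them apart from each other.\<close>
  define c where "c e = (if \<exists>i<k. e \<in> T i then THE i. i < k \<and> e \<in> T i else k + h e)" for e
  have c_T: "c e = i" if "i < k" "e \<in> T i" for i e
  proof -
    have "(THE i. i < k \<and> e \<in> T i) = i"
      using that assms(2) unfolding forest_packing_def disjoint_family_on_def
      by (intro the_equality) blast+
    then show ?thesis
      using that unfolding c_def by auto
  qed
  have c_unc: "c e = k + h e" if "e \<in> uncovered k E T" for e
    using that unfolding c_def uncovered_def by auto
  have "{..<k} \<subseteq> c ` E"
  proof
    fix i assume "i \<in> {..<k}"
    then obtain e where "e \<in> T i" "i < k" "e \<in> E"
      using assms(2,3) unfolding forest_packing_def by blast
    then show "i \<in> c ` E"
      using c_T by (metis imageI)
  qed
  moreover have "c ` uncovered k E T \<subseteq> c ` E"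
    unfolding uncovered_def by blast
  ultimately have "card ({..<k} \<union> c ` uncovered k E T) \<le> card (c ` E)"
    using assms(1) by (intro card_mono) auto
  moreover have "finite (uncovered k E T)"
    using assms(1) unfolding uncovered_def by blast
  then have "card ({..<k} \<union> c ` uncovered k E T) = k + card (c ` uncovered k E T)"
    using c_unc by (subst card_Un_disjoint) auto
  moreover have "inj_on c (uncovered k E T)"
  proof (rule inj_onI)
    fix e f assume "e \<in> uncovered k E T" "f \<in> uncovered k E T" "c e = c f"
    then show "e = f"
      using c_unc h unfolding uncovered_def by (simp add: inj_on_eq_iff)
  qed
  then have "card (c ` uncovered k E T) = card (uncovered k E T)"
    by (rule card_image)
  moreover have "card E \<le> card (uncovered k E T) + packing_size k T"
  proof -
    have sub: "(\<Union>i<k. T i) \<subseteq> E"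
      using assms(2) unfolding forest_packing_def by blast
    have "card (\<Union>i<k. T i) \<le> packing_size k T"
      unfolding packing_size_def by (rule card_UN_le) simp
    moreover have "card (uncovered k E T) = card E - card (\<Union>i<k. T i)"
      unfolding uncovered_def using sub assms(1) by (meson card_Diff_subset finite_subset)
    ultimately show ?thesis
      by linarith
  qed
  ultimately have "k + card E \<le> card (c ` E) + packing_size k T"
    by linarith
  then show thesis
    using c_T that by blast
qed

theorem corollary2p17:
  fixes V :: "'a set" and E :: "'a set set" and k n :: nat
  assumes "k \<ge> 2"
    and "simple_graph V E"
    and "card V = n"
    and "n \<ge> 2"
    and "Psi V E \<ge> int k"
  shows "int (mc k V E) \<ge> int (card E) - int k * (int n - 2)"
proof -
  have V: "finite V" "\<Union> E \<subseteq> V" "V \<noteq> {}" and E: "finite E"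
    using assms(2-4) simple_graph_finite_edges[OF assms(2)] by (auto simp: simple_graph_def)
  obtain T where T: "forest_packing k E T" "\<And>i. i < k \<Longrightarrow> Suc (card (T i)) = card V"
    "\<And>i u v. i < k \<Longrightarrow> u \<in> V \<Longrightarrow> v \<in> V \<Longrightarrow> (u, v) \<in> conn (T i)"
    using tree_packing[OF assms(2) V(3) Psi_le_quotient[OF V(1) assms(5)]] by blast
  \<comment> \<open>With at least two vertices each tree has an edge, so all \<open>k\<close> tree
    colors really occur.\<close>
  have "T i \<noteq> {}" if "i < k" for i
    using T(2)[OF that] assms(3,4) by auto
  then obtain c :: "'a set \<Rightarrow> nat" where c: "\<And>i e. i < k \<Longrightarrow> e \<in> T i \<Longrightarrow> c e = i"
    "k + card E \<le> card (c ` E) + packing_size k T"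
    using packing_coloring_exists[OF E T(1)] by blast
  have "card (c ` E) \<le> mc k V E"
    using mc_ge[OF E MC_coloring_of_packing[OF V(2) T(1,3) c(1)]] .
  moreover have "packing_size k T = k * (n - 1)"
  proof -
    have "(\<Sum>i<k. card (T i)) = (\<Sum>i<k. n - 1)"
      using T(2) assms(3) by (intro sum.cong) fastforce+
    then show ?thesis
      unfolding packing_size_def by simp
  qed
  \<comment> \<open>The \<open>k\<close> tree colors turn \<open>k * (n - 1)\<close> into the
    \<open>k * (n - 2)\<close> of the claim; \<open>n \<ge> 2\<close> makes the natural difference
    \<open>n - 1\<close> agree with the integer one.\<close>
  ultimately have "int k + int (card E) \<le> int (mc k V E) + int k * (int n - 1)"
  proof -
    have "int k + int (card E) \<le> int (card (c ` E)) + int k * int (n - 1)"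
      using c(2) \<open>packing_size k T = k * (n - 1)\<close> by (metis of_nat_add of_nat_le_iff of_nat_mult)
    then show ?thesis
      using \<open>card (c ` E) \<le> mc k V E\<close> assms(4) by (simp add: of_nat_diff)
  qed
  then show ?thesis
    by (simp add: algebra_simps)
qed

end
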